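(* Let $W=\{n \in \mathbb{N}: \text{for every prime } p,\ p\mid n \Rightarrow p^2\mid n\}$ be the set of powerful numbers. Assume either the $abc$ conjecture or the Schinzel–Tijdeman conjecture. Then there is no infinite Hilbert cube contained in $W$; that is, there do not exist a non-negative integer $a_0$ and an infinite sequence of positive integers $a_1,a_2,\ldots$ with $H(a_0;a_1,a_2,\ldots)\subset W$.
   Context: For an integer $a_0$ and an infinite sequence $a_1,a_2,\dots$, $H(a_0;a_1,a_2,\dots)=\{a_0+\sum_{i\ge 1}\varepsilon_i a_i : \varepsilon_i\in\{0,1\},\ \text{only finitely many } \varepsilon_i \ne 0\}$ when $a_0\neq0$; when $a_0=0$ the empty sum is excluded. The $abc$ conjecture: for every $\varepsilon>0$ there is $C_\varepsilon$ such that whenever $a+b=c$ for non-zero integers $a,b,c$ with $\gcd(a,b,c)=1$, one has $\max\{|a|,|b|,|c|\}\le C_\varepsilon P^{1+\varepsilon}$ where $P=\prod_{p\mid abc}p$ (product over primes). The Schinzel–Tijdeman conjecture: if a polynomial $P$ with rational coefficients has at least three simple zeros, then the equation $y^2z^3=P(x)$ has only finitely many solutions in integers $x,y,z$ with $yz\ne 0$. *)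

theory Defs
  imports Complex_Main "HOL-Computational_Algebra.Computational_Algebra"
begin

definition powerful_numbers :: "nat set" where
  "powerful_numbers = {n. n > 0 \<and> (\<forall>p. prime p \<longrightarrow> p dvd n \<longrightarrow> p ^ 2 dvd n)}"

(* A choice of coefficients eps_i in {0,1}, i >= 1, finitely many of them non-zero, is given by
   the finite set I of indices i with eps_i = 1.  The value a 0 is never used: the sequence
   a_1, a_2, ... is indexed from 1, and the offset a_0 is the separate argument a0. *)
definition hilbert_cube :: "int \<Rightarrow> (nat \<Rightarrow> int) \<Rightarrow> int set" where
  "hilbert_cube a0 a =
     {a0 + (\<Sum>i\<in>I. a i) | I. finite I \<and> I \<subseteq> {1..} \<and> (a0 = 0 \<longrightarrow> I \<noteq> {})}"

(* On int, prime_factors consists of the positive prime divisors, each taken once. *)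
definition abc_conjecture :: bool where
  "abc_conjecture \<longleftrightarrow>
     (\<forall>\<epsilon>::real. \<epsilon> > 0 \<longrightarrow> (\<exists>C::real. \<forall>a b c :: int.
        a \<noteq> 0 \<longrightarrow> b \<noteq> 0 \<longrightarrow> c \<noteq> 0 \<longrightarrow> a + b = c \<longrightarrow> Gcd {a, b, c} = 1 \<longrightarrow>
        real_of_int (Max {\<bar>a\<bar>, \<bar>b\<bar>, \<bar>c\<bar>})
          \<le> C * real_of_int (\<Prod>p\<in>prime_factors (a * b * c). p) powr (1 + \<epsilon>)))"

(* Zeros are taken in the complex numbers, not only in the rationals.  The condition P \<noteq> 0
   is explicit because order z 0 is unspecified. *)
definition schinzel_tijdeman_conjecture :: bool where
  "schinzel_tijdeman_conjecture \<longleftrightarrow>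
     (\<forall>P :: rat poly.
        P \<noteq> 0 \<longrightarrow> card {z :: complex. order z (map_poly of_rat P) = 1} \<ge> 3 \<longrightarrow>
        finite {(x :: int, y :: int, z :: int).
          y * z \<noteq> 0 \<and> of_int (y ^ 2 * z ^ 3) = poly P (of_int x)})"

end

(* Three members of the cube whose gaps p = a_1 and q = a_2 stay fixed are found arbitrarily
   far out.

   Under Schinzel-Tijdeman, their product is u^2 v^3, a value of the cubic X (X + p) (X + p + q),
   which has three simple zeros.

   Under abc, centre the triple as y - p, y, y + q and use that
     (y - p)^p (y + q)^q = (-p)^p q^q + y^2 R,
   where the exponents are chosen to make y = 0 a critical point of the left side.  With N = p + q,
   the radical of the left side and that of y are O(y) and O(y^(1/2)), because a powerful number is
   at least the square of its radical, and |R| = O(y^(N - 2)).  So abc bounds the left side, of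
   order y^N, by a constant times y^((N - 1/2)(1 + eps)), which fails for eps = 1/(2N) and y large. *)
theory Submission imports Defs begin

section \<open>Powerful numbers as a square times a cube\<close>

text \<open>Write \<open>n = s * t ^ 2\<close> with \<open>s\<close> squarefree. A prime dividing
  \<open>s\<close> divides \<open>n\<close>, hence \<open>p ^ 2\<close> divides \<open>n\<close> and
  \<open>p\<close> divides \<open>t\<close>. As \<open>s\<close> is squarefree, \<open>s\<close>
  divides \<open>t\<close>, and \<open>t = s * u\<close> gives
  \<open>n = u ^ 2 * s ^ 3\<close>.\<close>

lemma powerful_numbers_square_cube:
  assumes "n \<in> powerful_numbers"
  obtains u v where "u > 0" "v > 0" "n = u ^ 2 * v ^ 3"
proof -
  have n: "n > 0" and pw: "\<And>p. prime p \<Longrightarrow> p dvd n \<Longrightarrow> p ^ 2 dvd n"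
    using assms by (auto simp: powerful_numbers_def)
  define s t where "s = squarefree_part n" and "t = square_part n"
  have st: "n = s * t ^ 2"
    unfolding s_def t_def by (rule squarefree_decompose)
  have "s > 0" "t > 0"
    using st n by (auto intro: gr0I)
  have "s dvd t"
  proof (rule multiplicity_le_imp_dvd)
    show "s \<noteq> 0" using \<open>s > 0\<close> by simp
    fix p :: nat assume p: "prime p"
    have "multiplicity p s \<le> 1"
      using p prime_multiplicity_squarefree_part_le_Suc_0[of p n] by (simp add: s_def)
    moreover have "multiplicity p t \<ge> 1" if "p dvd s"
    proof -
      have "p dvd n" using that st by simp
      hence "p ^ 2 dvd n" using pw p by blast
      hence "p dvd t" by (simp add: t_def dvd_square_part_iff)
      thus ?thesis using p \<open>t > 0\<close>
        by (metis Suc_leI One_nat_def neq0_conv prime_multiplicity_gt_zero_iff prime_imp_prime_elem)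
    qed
    ultimately show "multiplicity p s \<le> multiplicity p t"
      by (cases "p dvd s") (auto simp: not_dvd_imp_multiplicity_0)
  qed
  then obtain u where "t = s * u" by (elim dvdE)
  hence "n = u ^ 2 * s ^ 3" "u > 0"
    using st \<open>t > 0\<close> by (auto simp: power2_eq_square power3_eq_cube intro: gr0I)
  thus ?thesis using that \<open>s > 0\<close> by blast
qed

subsection \<open>Radicals of integers\<close>

text \<open>The product that occurs in \<open>abc_conjecture\<close>. Its value at 0 is the empty
  product 1, so it is positive everywhere.\<close>

definition radical_int :: "int \<Rightarrow> int" where
  "radical_int n = \<Prod>(prime_factors n)"

lemma radical_int_pos [simp]: "radical_int n > 0"
  unfolding radical_int_def by (intro prod_pos) (auto simp: prime_factors_gt_0_int)

lemma radical_int_mono: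
  assumes "m dvd n" "n \<noteq> 0"
  shows "radical_int m \<le> radical_int n"
proof -
  have sub: "prime_factors m \<subseteq> prime_factors n"
    using assms by (simp add: dvd_prime_factors)
  show ?thesis unfolding radical_int_def
    by (rule prod_mono2) (use sub in \<open>auto dest!: in_prime_factors_imp_prime prime_ge_1_int\<close>)
qed

text \<open>The two sides differ by the product of the common primes, which is at least 1.\<close>

lemma radical_int_mult_le:
  assumes "m \<noteq> 0" "n \<noteq> 0"
  shows "radical_int (m * n) \<le> radical_int m * radical_int n"
proof -
  let ?M = "prime_factors m" and ?N = "prime_factors n"
  have "\<Prod>?M * \<Prod>?N = \<Prod>(?M \<union> ?N) * \<Prod>(?M \<inter> ?N)"
    by (simp add: prod.union_inter)
  moreover have "\<Prod>(?M \<inter> ?N) \<ge> 1"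
    by (rule prod_ge_1) (auto dest!: in_prime_factors_imp_prime prime_ge_1_int)
  moreover have "\<Prod>(?M \<union> ?N) \<ge> 0"
    by (rule prod_nonneg) (auto simp: prime_factors_ge_0_int)
  ultimately show ?thesis
    using assms by (simp add: radical_int_def prime_factors_product mult_le_cancel_left1)
qed

lemma radical_int_le_abs:
  assumes "n \<noteq> 0"
  shows "radical_int n \<le> \<bar>n\<bar>"
proof -
  have "radical_int n \<le> (\<Prod>p\<in>prime_factors n. p ^ multiplicity p n)"
    unfolding radical_int_def
  proof (rule prod_mono)
    fix p assume p: "p \<in> prime_factors n"
    hence "p \<ge> 1" "multiplicity p n > 0"
      by (auto dest!: in_prime_factors_imp_prime prime_ge_1_int simp: prime_factors_multiplicity)
    thus "0 \<le> p \<and> p \<le> p ^ multiplicity p n" by (simp add: self_le_power)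
  qed
  thus ?thesis using assms by (simp add: prod_prime_factors)
qed

lemma radical_int_power_le:
  "radical_int (n ^ k) \<le> radical_int n"
proof -
  have "prime_factors (n ^ k) \<subseteq> prime_factors n"
  proof
    fix p assume "p \<in> prime_factors (n ^ k)"
    hence p: "prime p" "p dvd n ^ k" "n ^ k \<noteq> 0" by (auto simp: in_prime_factors_iff)
    \<comment> \<open>With \<open>k \<noteq> 0\<close>, \<open>n ^ k \<noteq> 0\<close> gives
      \<open>n \<noteq> 0\<close>, which membership in \<open>prime_factors n\<close>
      demands.\<close>
    hence "k \<noteq> 0" by (metis not_prime_unit power_0)
    moreover have "p dvd n" using p by (blast intro: prime_dvd_power)
    ultimately show "p \<in> prime_factors n" using p by (auto simp: in_prime_factors_iff)
  qed
  thus ?thesis unfolding radical_int_def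
    by (intro prod_mono2) (auto dest!: in_prime_factors_imp_prime prime_ge_1_int)
qed

text \<open>For \<open>n = u ^ 2 * v ^ 3\<close> the radical is at most \<open>u * v\<close>, and
  \<open>(u * v) ^ 2 * v = n\<close>.\<close>

lemma radical_int_powerful:
  assumes "n \<in> int ` powerful_numbers"
  shows "(radical_int n) ^ 2 \<le> n"
proof -
  from assms obtain m where m: "m \<in> powerful_numbers" "n = int m" by blast
  obtain u v where uv: "u > 0" "v > 0" "m = u ^ 2 * v ^ 3"
    using powerful_numbers_square_cube[OF m(1)] .
  have "radical_int n \<le> radical_int (int u ^ 2) * radical_int (int v ^ 3)"
    using radical_int_mult_le[of "int u ^ 2" "int v ^ 3"] uv m by simp
  also have "\<dots> \<le> radical_int (int u) * radical_int (int v)"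
    by (intro mult_mono radical_int_power_le) (auto intro: less_imp_le)
  also have "\<dots> \<le> int u * int v"
    using radical_int_le_abs[of "int u"] radical_int_le_abs[of "int v"] uv
    by (intro mult_mono) (auto intro: less_imp_le)
  finally have "(radical_int n) ^ 2 \<le> (int u * int v) ^ 2"
    by (intro power_mono) (auto intro: less_imp_le)
  also have "\<dots> \<le> (int u * int v) ^ 2 * int v"
    using uv by (simp add: mult_le_cancel_left1)
  also have "\<dots> = n"
    using uv m by (simp add: power2_eq_square power3_eq_cube algebra_simps)
  finally show ?thesis .
qed

text \<open>The bound is in terms of any \<open>z\<close> above \<open>n\<close>, so that all
  members of a triple can be measured by the largest one.\<close>

lemma radical_int_powerful_le_powr:
  assumes "n \<in> int ` powerful_numbers" "n \<le> z"
  shows "real_of_int (radical_int n) \<le> real_of_int z powr (1/2)"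
proof -
  have "(real_of_int (radical_int n)) ^ 2 \<le> real_of_int z"
    using radical_int_powerful[OF assms(1)] assms(2)
    by (metis of_int_power of_int_le_iff order_trans)
  hence "real_of_int (radical_int n) \<le> sqrt (real_of_int z)"
    by (rule real_le_rsqrt)
  moreover have "z \<ge> 0" using assms by auto
  ultimately show ?thesis by (simp add: powr_half_sqrt)
qed

subsection \<open>Consequences of the abc conjecture\<close>

(* The common factor of a, b and c divides a, so removing the coprimality hypothesis
   costs at most a factor of |a|. *)
lemma abc_conjecture_not_coprime:
  assumes "abc_conjecture" "\<epsilon> > 0"
  obtains C :: real where "C > 0"
    "\<And>a b c :: int. a \<noteq> 0 \<Longrightarrow> b \<noteq> 0 \<Longrightarrow> c \<noteq> 0 \<Longrightarrow> a + b = c \<Longrightarrow>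
       real_of_int \<bar>c\<bar> \<le> C * real_of_int \<bar>a\<bar> * real_of_int (radical_int (a * b * c)) powr (1 + \<epsilon>)"
proof -
  obtain C where C: "\<And>a b c :: int. a \<noteq> 0 \<Longrightarrow> b \<noteq> 0 \<Longrightarrow> c \<noteq> 0 \<Longrightarrow> a + b = c \<Longrightarrow>
      Gcd {a, b, c} = 1 \<Longrightarrow> real_of_int (Max {\<bar>a\<bar>, \<bar>b\<bar>, \<bar>c\<bar>})
          \<le> C * real_of_int (radical_int (a * b * c)) powr (1 + \<epsilon>)"
    using assms unfolding abc_conjecture_def radical_int_def by meson
  \<comment> \<open>\<open>C\<close> might a priori be negative; enlarging it secures the sign used
    in the estimates below.\<close>
  define D where "D = max C 1"
  show ?thesis
  proof (rule that[of D])
    show "D > 0" by (simp add: D_def)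
    fix a b c :: int
    assume nz: "a \<noteq> 0" "b \<noteq> 0" "c \<noteq> 0" and sum: "a + b = c"
    define g where "g = Gcd {a, b, c}"
    have gd: "g dvd a" "g dvd b" "g dvd c" unfolding g_def by (rule Gcd_dvd; simp)+
    obtain a' b' c' where d: "a = g * a'" "b = g * b'" "c = g * c'"
      using gd by (elim dvdE)
    have "g > 0" using nz by (auto simp: g_def gcd_pos_int)
    \<comment> \<open>As an image under multiplication by \<open>g\<close>, the triple lets
      \<open>g\<close> be pulled out of its \<open>Gcd\<close>.\<close>
    have img: "(*) g ` {a', b', c'} = {a, b, c}" by (simp add: d)
    have "g = Gcd ((*) g ` {a', b', c'})" unfolding img by (rule g_def)
    also have "\<dots> = g * Gcd {a', b', c'}"
      using \<open>g > 0\<close> by (simp only: Gcd_mult normalize_mult normalize_Gcd) simp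
    finally have "g * Gcd {a', b', c'} = g" by simp
    hence cop: "Gcd {a', b', c'} = 1" using \<open>g > 0\<close> by simp
    have nz': "a' \<noteq> 0" "b' \<noteq> 0" "c' \<noteq> 0" using nz d by auto
    have sum': "a' + b' = c'"
      using sum d \<open>g > 0\<close> by (metis distrib_left less_irrefl mult_cancel_left)
    let ?r' = "real_of_int (radical_int (a' * b' * c'))"
    let ?r = "real_of_int (radical_int (a * b * c))"
    have "?r' \<le> ?r"
      using nz unfolding of_int_le_iff by (intro radical_int_mono) (auto simp: d)
    hence rr: "?r' powr (1 + \<epsilon>) \<le> ?r powr (1 + \<epsilon>)"
      using assms(2) by (intro powr_mono2) (auto intro: less_imp_le)
    have "real_of_int \<bar>c'\<bar> \<le> real_of_int (Max {\<bar>a'\<bar>, \<bar>b'\<bar>, \<bar>c'\<bar>})"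
      by simp
    also have "\<dots> \<le> C * ?r' powr (1 + \<epsilon>)" by (rule C[OF nz' sum' cop])
    also have "\<dots> \<le> D * ?r powr (1 + \<epsilon>)"
      using rr by (intro mult_mono) (auto simp: D_def)
    finally have c': "real_of_int \<bar>c'\<bar> \<le> D * ?r powr (1 + \<epsilon>)" .
    have "real_of_int \<bar>c\<bar> = real_of_int g * real_of_int \<bar>c'\<bar>"
      using \<open>g > 0\<close> by (simp add: d abs_mult)
    also have "\<dots> \<le> real_of_int \<bar>a\<bar> * (D * ?r powr (1 + \<epsilon>))"
    proof (intro mult_mono c')
      show "real_of_int g \<le> real_of_int \<bar>a\<bar>"
        using gd(1) nz dvd_imp_le_int[of a g] \<open>g > 0\<close> by simp
    qed auto
    finally show "real_of_int \<bar>c\<bar> \<le> D * real_of_int \<bar>a\<bar> * ?r powr (1 + \<epsilon>)"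
      by (simp add: mult_ac)
  qed
qed

text \<open>The first-order Taylor expansion at \<open>y = 0\<close>. The exponent
  \<open>Suc n\<close> keeps truncated subtraction out of the linear term.\<close>

lemma square_dvd_add_power_diff:
  fixes y c :: "'a :: comm_ring_1"
  shows "y ^ 2 dvd (y + c) ^ Suc n - (c ^ Suc n + of_nat (Suc n) * c ^ n * y)"
proof (induction n)
  case (Suc n)
  then obtain k where k: "(y + c) ^ Suc n = c ^ Suc n + of_nat (Suc n) * c ^ n * y + y ^ 2 * k"
    by (metis dvdE add.commute diff_add_cancel)
  have "(y + c) ^ Suc (Suc n) = (y + c) * (c ^ Suc n + of_nat (Suc n) * c ^ n * y + y ^ 2 * k)"
    using k by simp
  hence "(y + c) ^ Suc (Suc n) - (c ^ Suc (Suc n) + of_nat (Suc (Suc n)) * c ^ Suc n * y)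
        = y ^ 2 * (of_nat (Suc n) * c ^ n + (y + c) * k)"
    by (simp add: algebra_simps power2_eq_square)
  thus ?case by (metis dvd_triv_left)
qed auto

text \<open>Modulo \<open>y ^ 2\<close> the two factors are \<open>(- int p) ^ p * (1 - y)\<close>
  and \<open>int q ^ q * (1 + y)\<close>, so the linear terms cancel in the product.\<close>

lemma square_dvd_critical_value:
  fixes y :: int and p q :: nat
  assumes "p > 0" "q > 0"
  shows "y ^ 2 dvd (y - int p) ^ p * (y + int q) ^ q - (- int p) ^ p * int q ^ q"
proof -
  have lin: "\<exists>k. (y + c) ^ n = c ^ n + int n * c ^ (n - 1) * y + y ^ 2 * k" if "n > 0" for c n
    using square_dvd_add_power_diff[of y c "n - 1"] that
    by (metis Suc_diff_1 dvdE add.commute diff_add_cancel)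
  obtain k where "(y - int p) ^ p = (- int p) ^ p + int p * (- int p) ^ (p - 1) * y + y ^ 2 * k"
    using lin[OF assms(1), of "- int p"] by auto
  \<comment> \<open>Here the exponent must match the shift: the factor \<open>p\<close> from
    differentiation restores the full power, up to sign.\<close>
  moreover have "int p * (- int p) ^ (p - 1) = - ((- int p) ^ p)"
    using assms(1) by (cases p) (auto simp: algebra_simps)
  ultimately have 1: "(y - int p) ^ p = (- int p) ^ p * (1 - y) + y ^ 2 * k"
    by (simp add: algebra_simps)
  obtain l where "(y + int q) ^ q = int q ^ q + int q * int q ^ (q - 1) * y + y ^ 2 * l"
    using lin[OF assms(2), of "int q"] by auto
  moreover have "int q * int q ^ (q - 1) = int q ^ q"
    using assms(2) by (cases q) auto
  ultimately have 2: "(y + int q) ^ q = int q ^ q * (1 + y) + y ^ 2 * l"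
    by (simp add: algebra_simps)
  define P Q where "P = (- int p) ^ p" and "Q = int q ^ q"
  have "(P * (1 - y) + y ^ 2 * k) * (Q * (1 + y) + y ^ 2 * l) - P * Q
      = y ^ 2 * (P * (1 - y) * l + k * (Q * (1 + y)) + y ^ 2 * k * l - P * Q)"
    by (simp add: algebra_simps power2_eq_square)
  thus ?thesis
    unfolding 1 2 P_def[symmetric] Q_def[symmetric] by (metis dvd_triv_left)
qed

text \<open>The abc bound is applied to \<open>k + y ^ 2 * R = c\<close>. Since \<open>k\<close>
  depends only on the gaps, the factor lost to a common divisor is a constant. All sizes are
  compared with the largest member \<open>z\<close>.\<close>

lemma abc_powerful_triples_bounded:
  fixes p q :: nat
  assumes "abc_conjecture" "p > 0" "q > 0"
  obtains B :: real where
    "\<And>y :: int. \<lbrakk>y - int p \<in> int ` powerful_numbers; y \<in> int ` powerful_numbers;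
        y + int q \<in> int ` powerful_numbers\<rbrakk> \<Longrightarrow> real_of_int y \<le> B"
proof -
  define N where "N = p + q"
  define k where "k = (- int p) ^ p * int q ^ q"
  define K where "K = real_of_int \<bar>k\<bar>"
  define \<epsilon> where "\<epsilon> = 1 / (2 * real N)"
  have N: "N \<ge> 2" using assms by (simp add: N_def)
  have "\<epsilon> > 0" using N by (simp add: \<epsilon>_def)
  have "k \<noteq> 0" using assms by (simp add: k_def)
  hence "K > 0" by (simp add: K_def)
  obtain C where "C > 0" and C:
    "\<And>a b c :: int. a \<noteq> 0 \<Longrightarrow> b \<noteq> 0 \<Longrightarrow> c \<noteq> 0 \<Longrightarrow> a + b = c \<Longrightarrow>
       real_of_int \<bar>c\<bar> \<le> C * real_of_int \<bar>a\<bar> * real_of_int (radical_int (a * b * c)) powr (1 + \<epsilon>)"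
    using abc_conjecture_not_coprime[OF assms(1) \<open>\<epsilon> > 0\<close>] by blast
  \<comment> \<open>\<open>2 ^ N\<close> comes from \<open>z \<le> 2 * x\<close>,
    \<open>C * K\<close> from the abc bound with \<open>a = k\<close>, and the last factor from the
    radical bound \<open>8 * K * Z powr (real N - 1/2)\<close>.\<close>
  define M where "M = 2 ^ N * C * K * (8 * K) powr (1 + \<epsilon>)"
  \<comment> \<open>The first threshold gives \<open>z \<le> 2 * x\<close>, the second
    \<open>x > \<bar>k\<bar>\<close>, and the third contradicts the final estimate.\<close>
  define B where "B = Max {real (2 * p + q), K + real p, M powr (4 * real N)}"
  have "real_of_int y \<le> B"
    if x_pw: "y - int p \<in> int ` powerful_numbers" and y_pw: "y \<in> int ` powerful_numbers"
      and z_pw: "y + int q \<in> int ` powerful_numbers" for y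
  proof (rule ccontr)
    assume "\<not> real_of_int y \<le> B"
    hence "real_of_int y > real (2 * p + q)" "real_of_int y > K + real p"
      and yM: "real_of_int y > M powr (4 * real N)"
      by (auto simp: B_def)
    hence y: "y > 2 * int p + int q" "y > \<bar>k\<bar> + int p"
      unfolding K_def by linarith+
    define x z where "x = y - int p" and "z = y + int q"
    have xyz: "x > 0" "x > \<bar>k\<bar>" "y > 0" "z > 0" "z \<le> 2 * x" "z \<le> 2 * y" "x \<le> z" "y \<le> z"
      using y by (auto simp: x_def z_def)
    define Z where "Z = real_of_int z"
    have Z: "Z > 0" "Z > M powr (4 * real N)" using yM xyz by (auto simp: Z_def)
    define c where "c = x ^ p * z ^ q"
    obtain R where R: "c - k = y ^ 2 * R"
      using square_dvd_critical_value[OF assms(2,3), of y] unfolding c_def k_def x_def z_def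
      by (elim dvdE)
    have "c \<ge> x"
    proof -
      have "x * 1 \<le> x ^ p * z ^ q"
        using xyz assms by (intro mult_mono self_le_power one_le_power) auto
      thus ?thesis by (simp add: c_def)
    qed
    \<comment> \<open>This excludes \<open>c = k\<close>, hence \<open>R = 0\<close>, and later
      bounds \<open>\<bar>c - k\<bar>\<close> by \<open>2 * c\<close>.\<close>
    hence "c > \<bar>k\<bar>" "c > 0" using xyz by auto
    hence "R \<noteq> 0" using R by auto
    have "c \<le> z ^ N"
      unfolding c_def N_def power_add using xyz by (intro mult_right_mono power_mono) auto
    moreover have y2R: "y ^ 2 * \<bar>R\<bar> = \<bar>c - k\<bar>" by (simp add: R abs_mult)
    ultimately have "y ^ 2 * \<bar>R\<bar> \<le> 2 * z ^ N"
      using \<open>c > \<bar>k\<bar>\<close> by linarith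
    moreover have "z ^ 2 \<le> (2 * y) ^ 2" using xyz by (intro power_mono) auto
    hence "z ^ 2 * \<bar>R\<bar> \<le> (2 * y) ^ 2 * \<bar>R\<bar>" by (intro mult_right_mono) auto
    \<comment> \<open>The constant 8 is 2 from \<open>\<bar>c - k\<bar> \<le> 2 * z ^ N\<close>
      times 4 from \<open>z \<le> 2 * y\<close>.\<close>
    ultimately have "z ^ 2 * \<bar>R\<bar> \<le> 8 * z ^ N" by simp
    hence "real_of_int (z ^ 2 * \<bar>R\<bar>) \<le> real_of_int (8 * z ^ N)" by (simp only: of_int_le_iff)
    hence ZR: "Z ^ 2 * real_of_int \<bar>R\<bar> \<le> 8 * Z ^ N" by (simp add: Z_def)
    define r where "r = radical_int (k * (y ^ 2 * R) * c)"
    have "r \<le> radical_int k * (radical_int y * radical_int R) * (radical_int x * radical_int z)"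
    proof -
      have "radical_int c \<le> radical_int (x ^ p) * radical_int (z ^ q)"
        unfolding c_def using xyz by (intro radical_int_mult_le) auto
      also have "\<dots> \<le> radical_int x * radical_int z"
        by (intro mult_mono radical_int_power_le) (auto intro: less_imp_le)
      finally have c: "radical_int c \<le> radical_int x * radical_int z" .
      have "radical_int (y ^ 2 * R) \<le> radical_int (y ^ 2) * radical_int R"
        using xyz \<open>R \<noteq> 0\<close> by (intro radical_int_mult_le) auto
      also have "\<dots> \<le> radical_int y * radical_int R"
        by (intro mult_right_mono radical_int_power_le) (auto intro: less_imp_le)
      finally have b: "radical_int (y ^ 2 * R) \<le> radical_int y * radical_int R" .
      have "r \<le> radical_int (k * (y ^ 2 * R)) * radical_int c"
        unfolding r_def using xyz \<open>R \<noteq> 0\<close> \<open>k \<noteq> 0\<close> \<open>c > 0\<close> by (intro radical_int_mult_le) auto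
      also have "\<dots> \<le> radical_int k * radical_int (y ^ 2 * R) * radical_int c"
        using xyz \<open>R \<noteq> 0\<close> \<open>k \<noteq> 0\<close>
        by (intro mult_right_mono radical_int_mult_le) (auto intro: less_imp_le)
      also have "\<dots> \<le> radical_int k * (radical_int y * radical_int R) * (radical_int x * radical_int z)"
        by (intro mult_mono b c order_refl) (auto intro: less_imp_le)
      finally show ?thesis .
    qed
    hence "real_of_int r \<le> real_of_int (radical_int k) * (real_of_int (radical_int y) *
        real_of_int (radical_int R)) * (real_of_int (radical_int x) * real_of_int (radical_int z))"
      by (metis of_int_le_iff of_int_mult)
    \<comment> \<open>Only the three powerful numbers gain a square root; \<open>k\<close> and
      \<open>R\<close> are bounded by their absolute values.\<close>
    also have "\<dots> \<le> K * (Z powr (1/2) * real_of_int \<bar>R\<bar>) * (Z powr (1/2) * Z powr (1/2))"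
      unfolding K_def Z_def
      using radical_int_powerful_le_powr[OF x_pw, of z] radical_int_powerful_le_powr[OF y_pw, of z]
        radical_int_powerful_le_powr[OF z_pw, of z] xyz \<open>R \<noteq> 0\<close> \<open>k \<noteq> 0\<close>
      by (intro mult_mono)
         (auto simp: x_def z_def of_int_abs[symmetric] simp del: of_int_abs
               intro!: radical_int_le_abs intro: less_imp_le mult_nonneg_nonneg)
    also have "\<dots> = K * (Z powr (1/2) * Z) * real_of_int \<bar>R\<bar>"
    proof -
      have "Z powr (1/2) * Z powr (1/2) = Z" using Z by (simp add: powr_add[symmetric])
      thus ?thesis by (simp only: mult_ac)
    qed
    \<comment> \<open>Multiplying by \<open>Z ^ 2\<close> makes \<open>ZR\<close> applicable without
      the exponent \<open>N - 2\<close>.\<close>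
    finally have "real_of_int r * Z ^ 2 \<le> K * (Z powr (1/2) * Z) * real_of_int \<bar>R\<bar> * Z ^ 2"
      by (rule mult_right_mono) auto
    also have "\<dots> = K * (Z powr (1/2) * Z) * (Z ^ 2 * real_of_int \<bar>R\<bar>)" by (simp add: mult_ac)
    also have "\<dots> \<le> K * (Z powr (1/2) * Z) * (8 * Z ^ N)"
      using ZR \<open>K > 0\<close> Z by (intro mult_left_mono) auto
    also have "\<dots> = 8 * K * Z powr (real N - 1/2) * Z ^ 2"
    proof -
      have "Z powr (1/2) * Z * Z ^ N = Z powr (1/2 + 1 + real N)"
        using Z by (simp only: powr_add) (simp add: powr_realpow)
      also have "\<dots> = Z powr ((real N - 1/2) + 2)" by (simp add: algebra_simps)
      also have "\<dots> = Z powr (real N - 1/2) * Z ^ 2" using Z by (simp only: powr_add) simp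
      finally show ?thesis by (simp add: mult_ac)
    qed
    finally have r: "real_of_int r \<le> 8 * K * Z powr (real N - 1/2)" using Z by simp
    have "Z ^ N \<le> 2 ^ N * real_of_int c"
    proof -
      have "z ^ N \<le> (2 * x) ^ p * (2 * z) ^ q"
        unfolding N_def power_add using xyz by (intro mult_mono power_mono) auto
      also have "\<dots> = 2 ^ N * c" by (simp add: c_def N_def power_add power_mult_distrib mult_ac)
      finally have "real_of_int (z ^ N) \<le> real_of_int (2 ^ N * c)" by (simp only: of_int_le_iff)
      thus ?thesis by (simp add: Z_def)
    qed
    also have "\<dots> \<le> 2 ^ N * (C * K * real_of_int r powr (1 + \<epsilon>))"
      using C[of k "y ^ 2 * R" c] R \<open>c > 0\<close> \<open>k \<noteq> 0\<close> \<open>R \<noteq> 0\<close> xyz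
      by (intro mult_left_mono) (auto simp: r_def K_def)
    also have "\<dots> \<le> 2 ^ N * (C * K * (8 * K * Z powr (real N - 1/2)) powr (1 + \<epsilon>))"
      using r \<open>C > 0\<close> \<open>K > 0\<close> \<open>\<epsilon> > 0\<close>
      by (intro mult_left_mono powr_mono2) (auto simp: r_def intro: less_imp_le)
    also have "\<dots> = M * Z powr ((real N - 1/2) * (1 + \<epsilon>))"
      using Z \<open>K > 0\<close> by (simp add: M_def powr_mult powr_powr)
    \<comment> \<open>The choice of \<open>\<epsilon>\<close> leaves the exponent
      \<open>1 / (4 * real N)\<close> below \<open>N\<close>, which forces \<open>Z\<close> to be
      bounded.\<close>
    also have "(real N - 1/2) * (1 + \<epsilon>) = real N - 1 / (4 * real N)"
      using N by (simp add: \<epsilon>_def field_simps)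
    finally have "Z powr (1 / (4 * real N)) * Z powr (real N - 1 / (4 * real N))
        \<le> M * Z powr (real N - 1 / (4 * real N))"
      using Z by (simp add: powr_add[symmetric] powr_realpow)
    hence "Z powr (1 / (4 * real N)) \<le> M" using Z by simp
    hence "(Z powr (1 / (4 * real N))) powr (4 * real N) \<le> M powr (4 * real N)"
      by (intro powr_mono2) auto
    hence "Z \<le> M powr (4 * real N)" using Z N by (simp add: powr_powr)
    thus False using Z by simp
  qed
  thus ?thesis by (rule that)
qed

subsection \<open>Consequences of the Schinzel-Tijdeman conjecture\<close>

text \<open>Order is additive on products: the linear factor contributes 1 and \<open>q\<close>, not
  vanishing at \<open>a\<close>, contributes 0.\<close>

lemma order_eq_1_linear_factor:
  fixes q :: "'a :: idom poly"
  assumes "poly q a \<noteq> 0"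
  shows "order a ([:-a, 1:] * q) = 1"
proof -
  have "[:-a, 1:] * q \<noteq> 0"
    using assms by (metis mult_eq_0_iff pCons_eq_0_iff one_neq_zero poly_0)
  hence "order a ([:-a, 1:] * q) = order a [:-a, 1:] + order a q" by (rule order_mult)
  thus ?thesis using order_power_n_n[of a 1] assms by (simp add: order_0I)
qed

text \<open>Numbers of the form \<open>u ^ 2 * v ^ 3\<close> are closed under multiplication, so
  each such \<open>x\<close> is the first coordinate of a solution for the cubic
  \<open>P\<close>.\<close>

lemma schinzel_tijdeman_powerful_triples_finite:
  fixes d e :: int
  assumes "schinzel_tijdeman_conjecture" "0 < d" "d < e"
  shows "finite {x. x \<in> int ` powerful_numbers \<and> x + d \<in> int ` powerful_numbers \<and>
                    x + e \<in> int ` powerful_numbers}" (is "finite ?X")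
proof -
  \<comment> \<open>The expansion of X (X + d) (X + e); its zeros 0, -d, -e are distinct because
    \<open>0 < d < e\<close>.\<close>
  define P :: "rat poly" where "P = [:0, of_int (d * e), of_int (d + e), 1:]"
  define D E where "D = (of_int d :: complex)" and "E = (of_int e :: complex)"
  have nz: "D \<noteq> 0" "E \<noteq> 0" "D \<noteq> E" using assms by (auto simp: D_def E_def)
  have mp: "map_poly of_rat P = [:0, D * E, D + E, 1:]"
    by (simp add: P_def D_def E_def map_poly_pCons of_rat_add of_rat_mult)
  have "order (0 :: complex) (map_poly of_rat P) = 1"
    using order_eq_1_linear_factor[of "[:D * E, D + E, 1:]" 0] nz by (simp add: mp)
  moreover have "order (- D) (map_poly of_rat P) = 1"
    using order_eq_1_linear_factor[of "[:0, E, 1:]" "- D"] nz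
    by (simp add: mp algebra_simps)
  moreover have "order (- E) (map_poly of_rat P) = 1"
    using order_eq_1_linear_factor[of "[:0, D, 1:]" "- E"] nz
    by (simp add: mp algebra_simps)
  ultimately have sub: "{0, - D, - E} \<subseteq> {z. order z (map_poly of_rat P) = 1}" by simp
  have mp0: "map_poly of_rat P \<noteq> (0 :: complex poly)" by (simp add: mp)
  \<comment> \<open>An infinite set has \<open>card\<close> 0, so three known elements bound the
    cardinality below only once finiteness is established.\<close>
  have "finite {z :: complex. order z (map_poly of_rat P) = 1}"
  proof (rule finite_subset)
    show "finite {z :: complex. poly (map_poly of_rat P) z = 0}"
      using mp0 by (rule poly_roots_finite)
    show "{z :: complex. order z (map_poly of_rat P) = 1} \<subseteq> {z. poly (map_poly of_rat P) z = 0}"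
      by (auto simp: order_root)
  qed
  from card_mono[OF this sub] have "card {z :: complex. order z (map_poly of_rat P) = 1} \<ge> 3"
    using nz by simp
  moreover have "P \<noteq> 0" by (simp add: P_def)
  ultimately have fin: "finite {(x :: int, y :: int, z :: int).
      y * z \<noteq> 0 \<and> of_int (y ^ 2 * z ^ 3) = poly P (of_int x)}" (is "finite ?S")
    using assms(1) unfolding schinzel_tijdeman_conjecture_def by blast
  have "?X \<subseteq> fst ` ?S"
  proof
    fix x assume x: "x \<in> ?X"
    have ex: "\<exists>u v. u * v \<noteq> 0 \<and> n = u ^ 2 * v ^ 3" if "n \<in> int ` powerful_numbers" for n :: int
    proof -
      from that obtain m where "m \<in> powerful_numbers" "n = int m" by blast
      moreover from this(1) obtain u v where "u > 0" "v > 0" "m = u ^ 2 * v ^ 3"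
        by (rule powerful_numbers_square_cube)
      ultimately show ?thesis by (intro exI[of _ "int u"] exI[of _ "int v"]) auto
    qed
    obtain u v where 1: "u * v \<noteq> 0" "x = u ^ 2 * v ^ 3" using ex x by blast
    obtain u' v' where 2: "u' * v' \<noteq> 0" "x + d = u' ^ 2 * v' ^ 3" using ex x by blast
    obtain u'' v'' where 3: "u'' * v'' \<noteq> 0" "x + e = u'' ^ 2 * v'' ^ 3" using ex x by blast
    have "(u * u' * u'') ^ 2 * (v * v' * v'') ^ 3 = x * (x + d) * (x + e)"
      \<comment> \<open>Equation \<open>1\<close> rewrites \<open>x\<close> itself, so it has to
        come after \<open>2\<close> and \<open>3\<close>, whose left sides contain
        \<open>x\<close>.\<close>
      unfolding 2 3 unfolding 1 by (simp add: power_mult_distrib mult_ac)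
    moreover have "poly P (of_int x) = of_int (x * (x + d) * (x + e))"
      by (simp add: P_def algebra_simps)
    ultimately have "of_int ((u * u' * u'') ^ 2 * (v * v' * v'') ^ 3) = poly P (of_int x)"
      by (simp only:)
    hence "(x, u * u' * u'', v * v' * v'') \<in> ?S" using 1(1) 2(1) 3(1) by simp
    thus "x \<in> fst ` ?S" by (rule image_eqI[rotated]) (simp only: fst_conv)
  qed
  thus ?thesis using fin by (rule finite_subset[OF _ finite_imageI])
qed

subsection \<open>Triples with fixed gaps in a Hilbert cube\<close>

lemma hilbert_cube_triples:
  assumes a0: "a0 \<ge> 0" and pos: "\<And>i. i \<ge> 1 \<Longrightarrow> a i > 0"
  shows "\<exists>x > int n. x \<in> hilbert_cube a0 a \<and> x + a 1 \<in> hilbert_cube a0 a \<and>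
           x + (a 1 + a 2) \<in> hilbert_cube a0 a"
proof -
  \<comment> \<open>These are \<open>n + 1\<close> indices, each contributing at least 1, so
    \<open>x > n\<close>. Indices 1 and 2 stay free to produce the gaps.\<close>
  define I where "I = {3..n + 3}"
  define x where "x = a0 + (\<Sum>i\<in>I. a i)"
  \<comment> \<open>Nonempty \<open>J\<close> covers the case \<open>a0 = 0\<close>, where the empty
    sum is excluded.\<close>
  have mem: "a0 + (\<Sum>i\<in>J. a i) \<in> hilbert_cube a0 a" if "finite J" "J \<subseteq> {1..}" "J \<noteq> {}" for J
    using that by (auto simp: hilbert_cube_def)
  have "(\<Sum>i\<in>I. 1) \<le> (\<Sum>i\<in>I. a i)"
  proof (rule sum_mono)
    fix i assume "i \<in> I"
    thus "1 \<le> a i" using pos[of i] by (simp add: I_def)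
  qed
  hence "x > int n" using a0 by (simp add: x_def I_def)
  moreover have "x \<in> hilbert_cube a0 a"
    unfolding x_def by (rule mem) (auto simp: I_def)
  moreover have "x + a 1 \<in> hilbert_cube a0 a"
    using mem[of "insert 1 I"] by (auto simp: I_def x_def algebra_simps)
  moreover have "x + (a 1 + a 2) \<in> hilbert_cube a0 a"
    using mem[of "insert 1 (insert 2 I)"] by (auto simp: I_def x_def algebra_simps)
  ultimately show ?thesis by blast
qed

theorem theorem6:
  assumes "abc_conjecture \<or> schinzel_tijdeman_conjecture"
  shows "\<not> (\<exists>(a0 :: int) (a :: nat \<Rightarrow> int).
           a0 \<ge> 0 \<and> (\<forall>i\<ge>1. a i > 0) \<and> hilbert_cube a0 a \<subseteq> int ` powerful_numbers)"
proof
  assume "\<exists>(a0 :: int) (a :: nat \<Rightarrow> int).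
           a0 \<ge> 0 \<and> (\<forall>i\<ge>1. a i > 0) \<and> hilbert_cube a0 a \<subseteq> int ` powerful_numbers"
  then obtain a0 and a :: "nat \<Rightarrow> int" where a0: "a0 \<ge> 0" and pos: "\<And>i. i \<ge> 1 \<Longrightarrow> a i > 0"
    and sub: "hilbert_cube a0 a \<subseteq> int ` powerful_numbers" by blast
  have pq: "a 1 > 0" "a 2 > 0" using pos by auto
  have triple: "\<exists>x > int n. x \<in> int ` powerful_numbers \<and> x + a 1 \<in> int ` powerful_numbers \<and>
      x + (a 1 + a 2) \<in> int ` powerful_numbers" for n
    using hilbert_cube_triples[where a = a and n = n, OF a0 pos] sub by (meson subsetD)
  from assms show False
  proof
    assume "abc_conjecture"
    then obtain B where B: "\<And>y :: int. \<lbrakk>y - int (nat (a 1)) \<in> int ` powerful_numbers;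
        y \<in> int ` powerful_numbers; y + int (nat (a 2)) \<in> int ` powerful_numbers\<rbrakk>
        \<Longrightarrow> real_of_int y \<le> B"
      by (rule abc_powerful_triples_bounded[where p = "nat (a 1)" and q = "nat (a 2)"])
         (use pq in auto)
    obtain x where x: "x > int (nat \<lceil>B\<rceil>)" "x \<in> int ` powerful_numbers"
      "x + a 1 \<in> int ` powerful_numbers" "x + (a 1 + a 2) \<in> int ` powerful_numbers"
      using triple by blast
    \<comment> \<open>The abc bound is centred at the middle member, so
      \<open>y = x + a 1\<close>.\<close>
    have "real_of_int (x + a 1) \<le> B"
      using x pq by (intro B) (auto simp: add.assoc)
    thus False using x(1) pq by linarith
  next
    assume "schinzel_tijdeman_conjecture"
    hence fin: "finite {x. x \<in> int ` powerful_numbers \<and> x + a 1 \<in> int ` powerful_numbers \<and>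
                    x + (a 1 + a 2) \<in> int ` powerful_numbers}" (is "finite ?X")
      using pq by (intro schinzel_tijdeman_powerful_triples_finite) auto
    \<comment> \<open>A triple beyond the maximum of the finite set; \<open>int (nat m)\<close> is
      at least \<open>m\<close> even for negative \<open>m\<close>.\<close>
    obtain x where x: "x > int (nat (Max ?X))" "x \<in> ?X" using triple by blast
    have "x \<le> Max ?X" using fin x(2) by (rule Max_ge)
    thus False using x(1) by linarith
  qed
qed

end
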